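(* Let $F$ be a vector lattice and let $H$ be an ideal in $F$. (1) For $g\in F$ the following are equivalent: $H\cap I_g$ is a projection band in $I_g$; $I_g\cap H+I_g\cap H^d=I_g$; $g\in H+H^d$. (2) Hence, if $G\subset F$ is such that $G\cup H$ is majorizing in $F$, then $H$ is a projection band in $F$ if and only if $H\cap I_g$ is a projection band in $I_g$ for every $g\in G$.
   Context: An ideal of a vector lattice $F$ is a linear subspace $E\subset F$ such that $|f|\le|e|$, $e\in E$, $f\in F$ imply $f\in E$. For $g\in F$, $I_g$ is the smallest ideal of $F$ containing $g$, a vector lattice in its own right. A set $G\subset F$ is majorizing if the smallest ideal of $F$ containing $G$ is $F$. For $G\subset F$, $G^d=\{f\in F:|f|\wedge|g|=0\text{ for all }g\in G\}$. An ideal $H$ in a vector lattice $E$ is a projection band in $E$ if $E=H+H^d_E$, where $H^d_E=H^d\cap E$ is the disjoint complement of $H$ in $E$. *)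

theory Defs
  imports Complex_Main "HOL-Library.Lattice_Algebras" "HOL-Library.Set_Algebras"
begin

text \<open>Real vector lattices, not assumed Archimedean; the modulus satisfies
  \<^term>\<open>\<bar>a\<bar> = sup a (- a)\<close> by the class axioms.\<close>

class vector_lattice = ordered_real_vector + lattice_ab_group_add_abs

text \<open>The vector lattice \<open>E\<close> is given as a subset of the ambient type, so that the ideals
  \<open>I\<^sub>g\<close> can be treated as vector lattices in their own right; the whole of \<open>F\<close> is
  \<^term>\<open>UNIV\<close>.\<close>

definition ideal_in :: "'a::vector_lattice set \<Rightarrow> 'a set \<Rightarrow> bool" where
  "ideal_in E H \<longleftrightarrow>
     subspace H \<and> H \<subseteq> E \<and> (\<forall>f\<in>E. \<forall>e\<in>H. \<bar>f\<bar> \<le> \<bar>e\<bar> \<longrightarrow> f \<in> H)"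

definition ideal_generated :: "'a::vector_lattice set \<Rightarrow> 'a set" where
  "ideal_generated A = ideal_in UNIV hull A"

definition principal_ideal :: "'a::vector_lattice \<Rightarrow> 'a set" where
  "principal_ideal g = ideal_generated {g}"

definition majorizing :: "'a::vector_lattice set \<Rightarrow> bool" where
  "majorizing G \<longleftrightarrow> ideal_generated G = UNIV"

definition disjoint_compl :: "'a::vector_lattice set \<Rightarrow> 'a set" where
  "disjoint_compl G = {f. \<forall>g\<in>G. inf \<bar>f\<bar> \<bar>g\<bar> = 0}"

text \<open>The sum is the elementwise sum of sets.\<close>

definition projection_band_in :: "'a::vector_lattice set \<Rightarrow> 'a set \<Rightarrow> bool" where
  "projection_band_in E H \<longleftrightarrow> ideal_in E H \<and> E = H + (disjoint_compl H \<inter> E)"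

end

theory Submission
  imports Defs
begin

text \<open>Everything rests on the observation that \<open>H + H\<^sup>d\<close> is again an ideal. Two facts give it: the
  disjoint complement of any set is an ideal (\<open>ideal_disjoint_compl\<close>), and the sum of two ideals
  is an ideal by the Riesz decomposition property (\<open>ideal_sum\<close>).

  Two further points relate \<open>I\<^sub>g\<close> to the whole space. The disjoint complement
  of \<open>H \<inter> I\<^sub>g\<close> taken within \<open>I\<^sub>g\<close> is just \<open>I\<^sub>g \<inter> H\<^sup>d\<close> (\<open>disjoint_compl_Int_ideal\<close>), which turns the
  statement that \<open>H \<inter> I\<^sub>g\<close> is a projection band in \<open>I\<^sub>g\<close> into the decomposition of \<open>I\<^sub>g\<close>. And if
  \<open>g = h + k\<close> with \<open>h \<in> H\<close> and \<open>k \<in> H\<^sup>d\<close>, then the modulus of each summand is at most the modulus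
  of \<open>g\<close> (\<open>disjoint_abs_le_abs_add\<close>), so both summands lie in \<open>I\<^sub>g\<close>; hence
  the ideal \<open>I\<^sub>g \<inter> H + I\<^sub>g \<inter> H\<^sup>d\<close> contains \<open>g\<close> and exhausts \<open>I\<^sub>g\<close>.

  The second part follows because an ideal that contains \<open>G\<close> and \<open>H\<close>, where \<open>G \<union> H\<close> is
  majorizing, is the whole space; this applies to \<open>H + H\<^sup>d\<close> as soon as it contains \<open>G\<close>.\<close>

lemma abs_scaleR_le:
  fixes f :: "'a::vector_lattice"
  shows "\<bar>r *\<^sub>R f\<bar> \<le> \<bar>r\<bar> *\<^sub>R \<bar>f\<bar>"
proof -
  have f: "f \<le> \<bar>f\<bar>" "- f \<le> \<bar>f\<bar>" by (auto simp: abs_ge_self abs_ge_minus_self)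
  have "\<bar>r\<bar> *\<^sub>R f \<le> \<bar>r\<bar> *\<^sub>R \<bar>f\<bar>" "\<bar>r\<bar> *\<^sub>R (- f) \<le> \<bar>r\<bar> *\<^sub>R \<bar>f\<bar>"
    by (rule scaleR_left_mono[OF f(1)], simp, rule scaleR_left_mono[OF f(2)], simp)
  then show ?thesis
    by (intro abs_leI) (auto simp: abs_if split: if_splits)
qed

lemma inf_add_le:
  fixes a b c :: "'a::lattice_ab_group_add"
  assumes "0 \<le> a" "0 \<le> b" "0 \<le> c"
  shows "inf (a + b) c \<le> inf a c + inf b c"
proof -
  have *: "inf a c + inf b c = inf (inf (a + b) (c + b)) (inf (a + c) (c + c))"
    by (simp add: add_inf_distrib_left add_inf_distrib_right)
  have c: "c \<le> c + b" "c \<le> a + c" "c \<le> c + c"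
    using assms by (auto simp: add_increasing2 add_increasing)
  have "inf (a + b) c \<le> c" by simp
  then show ?thesis unfolding *
    using c by (meson inf.cobounded1 inf.boundedI order_trans)
qed

text \<open>Disjoint summands cannot cancel. Meeting the triangle inequality for \<open>h = (h + k) - k\<close>
  with the modulus of \<open>h\<close> removes the contribution of \<open>k\<close>.\<close>

lemma disjoint_abs_le_abs_add:
  fixes h k :: "'a::vector_lattice"
  assumes "inf \<bar>h\<bar> \<bar>k\<bar> = 0"
  shows "\<bar>h\<bar> \<le> \<bar>h + k\<bar>"
proof -
  have "\<bar>h\<bar> \<le> \<bar>h + k\<bar> + \<bar>k\<bar>"
    using abs_triangle_ineq4[of "h + k" k] by simp
  then have "\<bar>h\<bar> = inf (\<bar>h + k\<bar> + \<bar>k\<bar>) \<bar>h\<bar>"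
    by (simp add: inf.absorb2)
  also have "\<dots> \<le> inf \<bar>h + k\<bar> \<bar>h\<bar> + inf \<bar>k\<bar> \<bar>h\<bar>"
    by (rule inf_add_le) auto
  also have "\<dots> = inf \<bar>h + k\<bar> \<bar>h\<bar>"
    using assms by (simp add: inf_commute)
  also have "\<dots> \<le> \<bar>h + k\<bar>" by simp
  finally show ?thesis .
qed

lemma ideal_inD:
  assumes "ideal_in UNIV H" "e \<in> H" "\<bar>f\<bar> \<le> \<bar>e\<bar>"
  shows "f \<in> H"
  using assms unfolding ideal_in_def by blast

lemma ideal_in_subspace: "ideal_in E H \<Longrightarrow> subspace H"
  unfolding ideal_in_def by blast

lemma ideal_Int:
  assumes "ideal_in UNIV H" "ideal_in UNIV K"
  shows "ideal_in UNIV (H \<inter> K)"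
  using assms unfolding ideal_in_def by (blast intro: subspace_inter)

lemma ideal_in_Int_right:
  assumes "ideal_in UNIV H" "ideal_in UNIV K"
  shows "ideal_in K (H \<inter> K)"
  using ideal_Int[OF assms] unfolding ideal_in_def by blast

text \<open>The Riesz decomposition property: splitting off \<open>inf x a\<close> leaves the positive part of
  \<open>x - a\<close>, which \<open>b\<close> dominates.\<close>

lemma Riesz_decomposition:
  fixes x a b :: "'a::vector_lattice"
  assumes "0 \<le> x" "0 \<le> a" "0 \<le> b" "x \<le> a + b"
  obtains u v where "x = u + v" "0 \<le> u" "u \<le> a" "0 \<le> v" "v \<le> b"
proof (rule that[of "inf x a" "x - inf x a"])
  have "x \<le> inf x a + b"
    using assms by (simp add: add_inf_distrib_right add_increasing2)
  then show "x - inf x a \<le> b" by (simp only: diff_le_eq add.commute)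
  have "inf x a \<le> x" by (rule inf_le1)
  then show "0 \<le> x - inf x a" by (simp only: diff_ge_0_iff_ge)
  show "x = inf x a + (x - inf x a)" by (rule add.commute[THEN trans, OF diff_add_cancel, symmetric])
qed (use assms in auto)

lemma ideal_sum:
  fixes H K :: "'a::vector_lattice set"
  assumes H: "ideal_in UNIV H" and K: "ideal_in UNIV K"
  shows "ideal_in UNIV (H + K)"
proof -
  have subspace: "subspace (H + K)"
    using subspace_sums[OF ideal_in_subspace[OF H] ideal_in_subspace[OF K]]
    by (simp add: set_plus_def Bex_def conj_ac)
  have pos: "x \<in> H + K" if "0 \<le> x" "x \<le> \<bar>a\<bar> + \<bar>b\<bar>" "a \<in> H" "b \<in> K" for x a b
  proof -
    obtain u v where uv: "x = u + v" "0 \<le> u" "u \<le> \<bar>a\<bar>" "0 \<le> v" "v \<le> \<bar>b\<bar>"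
      using Riesz_decomposition[of x "\<bar>a\<bar>" "\<bar>b\<bar>"] \<open>0 \<le> x\<close> \<open>x \<le> \<bar>a\<bar> + \<bar>b\<bar>\<close> by auto
    then have "u \<in> H" "v \<in> K"
      using ideal_inD[OF H \<open>a \<in> H\<close>, of u] ideal_inD[OF K \<open>b \<in> K\<close>, of v] by auto
    then show ?thesis using uv(1) by auto
  qed
  have "f \<in> H + K" if le: "\<bar>f\<bar> \<le> \<bar>e\<bar>" and "e \<in> H + K" for f e
  proof -
    obtain a b where ab: "e = a + b" "a \<in> H" "b \<in> K"
      using \<open>e \<in> H + K\<close> by (rule set_plus_elim)
    have bound: "\<bar>f\<bar> \<le> \<bar>a\<bar> + \<bar>b\<bar>"
      using le abs_triangle_ineq[of a b] ab(1) by simp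
    \<comment> \<open>The decomposition property needs a positive element, so \<open>f\<close> is written as the difference
       of its positive and its negative part.\<close>
    have "sup f 0 \<le> \<bar>f\<bar>" "sup (- f) 0 \<le> \<bar>f\<bar>"
      by (auto simp: abs_ge_self abs_ge_minus_self)
    then have "sup f 0 \<in> H + K" "sup (- f) 0 \<in> H + K"
      using pos[OF _ _ ab(2,3)] bound by (meson order_trans sup.cobounded2)+
    moreover have "f = sup f 0 - sup (- f) 0"
      using prts[of f] by (simp add: pprt_def nprt_def neg_sup_eq_inf)
    ultimately show ?thesis using subspace_diff[OF subspace] by metis
  qed
  then show ?thesis using subspace unfolding ideal_in_def by blast
qed

lemma disjoint_compl_solid:
  assumes "k \<in> disjoint_compl H" "\<bar>f\<bar> \<le> \<bar>k\<bar>"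
  shows "f \<in> disjoint_compl H"
  unfolding disjoint_compl_def
proof (intro CollectI ballI antisym)
  fix h assume "h \<in> H"
  have "inf \<bar>f\<bar> \<bar>h\<bar> \<le> inf \<bar>k\<bar> \<bar>h\<bar>" using assms(2) by (rule inf_mono) simp
  also have "\<dots> = 0" using assms(1) \<open>h \<in> H\<close> by (simp add: disjoint_compl_def)
  finally show "inf \<bar>f\<bar> \<bar>h\<bar> \<le> 0" .
qed simp

text \<open>Closure under addition is \<open>inf_add_le\<close>. For a multiple, \<open>c \<ge> 1\<close> is chosen with
  \<open>\<bar>r\<bar> \<le> c\<close>: scaling both entries of the infimum by such a \<open>c\<close> only enlarges it, and the
  common factor comes out.\<close>

lemma ideal_disjoint_compl:
  fixes H :: "'a::vector_lattice set"
  shows "ideal_in UNIV (disjoint_compl H)"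
proof -
  have "subspace (disjoint_compl H)"
  proof (rule subspaceI)
    show "0 \<in> disjoint_compl H" by (simp add: disjoint_compl_def inf.absorb1)
  next
    fix x y assume xy: "x \<in> disjoint_compl H" "y \<in> disjoint_compl H"
    show "x + y \<in> disjoint_compl H"
      unfolding disjoint_compl_def
    proof (intro CollectI ballI antisym)
      fix h assume "h \<in> H"
      have "inf \<bar>x + y\<bar> \<bar>h\<bar> \<le> inf (\<bar>x\<bar> + \<bar>y\<bar>) \<bar>h\<bar>"
        by (intro inf_mono abs_triangle_ineq order_refl)
      also have "\<dots> \<le> inf \<bar>x\<bar> \<bar>h\<bar> + inf \<bar>y\<bar> \<bar>h\<bar>" by (rule inf_add_le) auto
      also have "\<dots> = 0" using xy \<open>h \<in> H\<close> by (simp add: disjoint_compl_def)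
      finally show "inf \<bar>x + y\<bar> \<bar>h\<bar> \<le> 0" .
    qed simp
  next
    fix r x assume x: "x \<in> disjoint_compl H"
    show "r *\<^sub>R x \<in> disjoint_compl H"
      unfolding disjoint_compl_def
    proof (intro CollectI ballI antisym)
      fix h assume "h \<in> H"
      define c where "c = max 1 \<bar>r\<bar>"
      define m where "m = inf \<bar>r *\<^sub>R x\<bar> \<bar>h\<bar>"
      have c: "1 \<le> c" "\<bar>r\<bar> \<le> c" by (auto simp: c_def)
      have "m \<le> \<bar>r *\<^sub>R x\<bar>" by (simp add: m_def)
      also have "\<dots> \<le> c *\<^sub>R \<bar>x\<bar>"
        using abs_scaleR_le[of r x] scaleR_right_mono[OF c(2), of "\<bar>x\<bar>"] by simp
      finally have 1: "m \<le> c *\<^sub>R \<bar>x\<bar>" .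
      have "m \<le> \<bar>h\<bar>" by (simp add: m_def)
      also have "\<dots> \<le> c *\<^sub>R \<bar>h\<bar>" using scaleR_right_mono[OF c(1), of "\<bar>h\<bar>"] by simp
      finally have 2: "m \<le> c *\<^sub>R \<bar>h\<bar>" .
      have "inverse c *\<^sub>R m \<le> inf \<bar>x\<bar> \<bar>h\<bar>"
        using scaleR_left_mono[OF 1, of "inverse c"] scaleR_left_mono[OF 2, of "inverse c"] c(1)
        by simp
      also have "\<dots> = 0" using x \<open>h \<in> H\<close> by (simp add: disjoint_compl_def)
      finally have "inverse c *\<^sub>R m \<le> 0" .
      then show "inf \<bar>r *\<^sub>R x\<bar> \<bar>h\<bar> \<le> 0"
        using scaleR_left_mono[of "inverse c *\<^sub>R m" 0 c] c(1) by (simp add: m_def)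
    qed simp
  qed
  then show ?thesis using disjoint_compl_solid unfolding ideal_in_def by blast
qed

text \<open>An element \<open>f\<close> of the ideal \<open>I\<close> meets \<open>h \<in> H\<close> in \<open>\<bar>f\<bar> \<sqinter> \<bar>h\<bar>\<close>, which belongs to
  \<open>H \<inter> I\<close>; so disjointness from \<open>H \<inter> I\<close> already forces disjointness from \<open>H\<close>.\<close>

lemma disjoint_compl_Int_ideal:
  fixes H :: "'a::vector_lattice set"
  assumes H: "ideal_in UNIV H" and I: "ideal_in UNIV I"
  shows "disjoint_compl (H \<inter> I) \<inter> I = I \<inter> disjoint_compl H"
proof (intro equalityI subsetI)
  fix f assume f: "f \<in> disjoint_compl (H \<inter> I) \<inter> I"
  have "inf \<bar>f\<bar> \<bar>h\<bar> = 0" if "h \<in> H" for h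
  proof -
    let ?m = "inf \<bar>f\<bar> \<bar>h\<bar>"
    have m: "\<bar>?m\<bar> = ?m" by simp
    then have "?m \<in> H \<inter> I"
      using ideal_inD[OF H that, of ?m] ideal_inD[OF I, of f ?m] f by auto
    then have "inf \<bar>f\<bar> \<bar>?m\<bar> = 0" using f unfolding disjoint_compl_def by blast
    then show ?thesis unfolding m by simp
  qed
  then show "f \<in> I \<inter> disjoint_compl H" using f by (auto simp: disjoint_compl_def)
qed (auto simp: disjoint_compl_def)

lemma ideal_ideal_generated: "ideal_in UNIV (ideal_generated A)"
  unfolding ideal_generated_def
proof (rule hull_in)
  fix T :: "'a set set" assume T: "Ball T (ideal_in UNIV)"
  then have "subspace (\<Inter>T)" by (auto intro: subspace_Inter ideal_in_subspace)
  then show "ideal_in UNIV (\<Inter>T)" using T unfolding ideal_in_def by blast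
qed

lemma ideal_generated_subset:
  "ideal_in UNIV H \<Longrightarrow> A \<subseteq> H \<Longrightarrow> ideal_generated A \<subseteq> H"
  unfolding ideal_generated_def by (rule hull_minimal)

lemma ideal_principal_ideal: "ideal_in UNIV (principal_ideal g)"
  unfolding principal_ideal_def by (rule ideal_ideal_generated)

lemma mem_principal_ideal: "g \<in> principal_ideal g"
  unfolding principal_ideal_def ideal_generated_def using hull_subset[of "{g}"] by blast

lemma projection_band_in_Int_iff:
  fixes H :: "'a::vector_lattice set"
  assumes "ideal_in UNIV H" "ideal_in UNIV I"
  shows "projection_band_in I (H \<inter> I) \<longleftrightarrow> (I \<inter> H) + (I \<inter> disjoint_compl H) = I"
  unfolding projection_band_in_def
  using ideal_in_Int_right[OF assms] disjoint_compl_Int_ideal[OF assms]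
  by (auto simp: Int_commute)

text \<open>The components of \<open>g\<close> are dominated by \<open>g\<close>, so they lie in \<open>I\<^sub>g\<close>. The sum on the left is
  therefore an ideal containing \<open>g\<close>, and minimality of \<open>I\<^sub>g\<close> extends the decomposition of the
  single element \<open>g\<close> to all of \<open>I\<^sub>g\<close>.\<close>

lemma principal_ideal_decomposition_iff:
  fixes H :: "'a::vector_lattice set"
  assumes H: "ideal_in UNIV H"
  shows "(principal_ideal g \<inter> H) + (principal_ideal g \<inter> disjoint_compl H) = principal_ideal g
     \<longleftrightarrow> g \<in> H + disjoint_compl H"
    (is "?S = ?I \<longleftrightarrow> _")
proof
  assume "?S = ?I"
  then have "g \<in> ?S" using mem_principal_ideal by metis
  then show "g \<in> H + disjoint_compl H" by (auto elim!: set_plus_elim)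
next
  assume "g \<in> H + disjoint_compl H"
  then obtain h k where g: "g = h + k" and h: "h \<in> H" and k: "k \<in> disjoint_compl H"
    by (rule set_plus_elim)
  note I = ideal_principal_ideal[of g]
  have disj: "inf \<bar>h\<bar> \<bar>k\<bar> = 0" "inf \<bar>k\<bar> \<bar>h\<bar> = 0"
    using h k by (auto simp: disjoint_compl_def inf_commute)
  have "h \<in> ?I"
    using ideal_inD[OF I mem_principal_ideal] disjoint_abs_le_abs_add[OF disj(1)] g by simp
  moreover have "k \<in> ?I"
    using ideal_inD[OF I mem_principal_ideal] disjoint_abs_le_abs_add[OF disj(2)] g
    by (simp add: add.commute)
  ultimately have "g \<in> ?S" using g h k by auto
  moreover have "ideal_in UNIV ?S"
    by (intro ideal_sum ideal_Int I H ideal_disjoint_compl)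
  ultimately have "?I \<subseteq> ?S"
    by (metis ideal_generated_subset principal_ideal_def empty_subsetI insert_subset)
  moreover have "?S \<subseteq> ?I"
    using subspace_add[OF ideal_in_subspace[OF I]] by (auto elim!: set_plus_elim)
  ultimately show "?S = ?I" by blast
qed

theorem proposition3p1:
  fixes H :: "'a::vector_lattice set"
  assumes "ideal_in UNIV H"
  shows "(\<forall>g.
            (projection_band_in (principal_ideal g) (H \<inter> principal_ideal g) \<longleftrightarrow>
              (principal_ideal g \<inter> H) + (principal_ideal g \<inter> disjoint_compl H) = principal_ideal g)
          \<and> ((principal_ideal g \<inter> H) + (principal_ideal g \<inter> disjoint_compl H) = principal_ideal g \<longleftrightarrow>
              g \<in> H + disjoint_compl H))
       \<and> (\<forall>G. majorizing (G \<union> H) \<longrightarrow>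
            (projection_band_in UNIV H \<longleftrightarrow>
              (\<forall>g\<in>G. projection_band_in (principal_ideal g) (H \<inter> principal_ideal g))))"
proof -
  note band_iff = projection_band_in_Int_iff[OF assms ideal_principal_ideal]
  note mem_iff = principal_ideal_decomposition_iff[OF assms]
  have "projection_band_in UNIV H \<longleftrightarrow>
      (\<forall>g\<in>G. projection_band_in (principal_ideal g) (H \<inter> principal_ideal g))"
    if maj: "majorizing (G \<union> H)" for G
  proof -
    have D: "ideal_in UNIV (H + disjoint_compl H)"
      by (intro ideal_sum assms ideal_disjoint_compl)
    have "0 \<in> disjoint_compl H"
      using subspace_0[OF ideal_in_subspace[OF ideal_disjoint_compl]] .
    then have "H \<subseteq> H + disjoint_compl H"
      by (metis add.right_neutral set_plus_intro subsetI)
    then have "G \<subseteq> H + disjoint_compl H \<longleftrightarrow> H + disjoint_compl H = UNIV"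
      using ideal_generated_subset[OF D, of "G \<union> H"] maj unfolding majorizing_def by blast
    moreover have "projection_band_in UNIV H \<longleftrightarrow> H + disjoint_compl H = UNIV"
      using assms by (auto simp: projection_band_in_def)
    ultimately show ?thesis unfolding band_iff mem_iff by blast
  qed
  then show ?thesis using band_iff mem_iff by blast
qed

end
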